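(* Let $1<p<\infty$ and let $m$ be a positive integer. Define $Q^m:l_p\times l_p\to l_p$ by $Q^m(x,y)=\{(t_n^2+s_n)^m\}_{n=1}^\infty$ for $x=\{t_n\}_{n=1}^\infty$, $y=\{s_n\}_{n=1}^\infty\in l_p$. Then $Q^m$ is partially Gâteaux differentiable on $l_p\times l_p$ with respect to each variable, and for any $(\bar x,\bar y)\in l_p\times l_p$ with $\bar x=(\bar t_1,\bar t_2,\dots)$ and $\bar y=(\bar s_1,\bar s_2,\dots)$: (i) for any $v=\{t_n\}_{n=1}^\infty\in l_p\setminus\{\theta\}$, $$\partial_1Q^m(\bar x,\bar y)(v)=\nabla_1(Q^m)(\bar x,\bar y)(v)=\{t_n\}_{n=1}^\infty\begin{pmatrix}2m\bar t_1(\bar t_1^2+\bar s_1)^{m-1}&0&\cdots\\0&2m\bar t_2(\bar t_2^2+\bar s_2)^{m-1}&0\\\vdots&0&\ddots\end{pmatrix};$$ (ii) for any $u=\{s_n\}_{n=1}^\infty\in l_p\setminus\{\theta\}$, $$\partial_2Q^m(\bar x,\bar y)(u)=\nabla_2(Q^m)(\bar x,\bar y)(u)=\{s_n\}_{n=1}^\infty\begin{pmatrix}m(\bar t_1^2+\bar s_1)^{m-1}&0&\cdots\\0&m(\bar t_2^2+\bar s_2)^{m-1}&0\\\vdots&0&\ddots\end{pmatrix}.$$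
   Context: $l_p$ is the real sequence space with norm $\|\cdot\|_p$ and null element $\theta=(0,0,\dots)$. For $m=1$ the expression $(\cdot)^{m-1}$ equals $1$. The product of a sequence $\{t_n\}$ (as a row vector) with a diagonal matrix with entries $d_n$ is $\{d_nt_n\}$. $F:l_p\times l_p\to l_p$ is partially Gâteaux differentiable with respect to the first (second) variable at $(\bar x,\bar y)$ if for every $v\in l_p\setminus\{\theta\}$ the limit over real $t$, $\partial_1F(\bar x,\bar y)(v)=\lim_{t\to0}\frac{F(\bar x+tv,\bar y)-F(\bar x,\bar y)}{t}$ ($\partial_2F(\bar x,\bar y)(v)=\lim_{t\to0}\frac{F(\bar x,\bar y+tv)-F(\bar x,\bar y)}{t}$), exists in $l_p$. The partial Fréchet derivatives $\nabla_1F(\bar x,\bar y),\nabla_2F(\bar x,\bar y)$ are the continuous linear mappings $l_p\to l_p$ with $\lim_{u\to\theta}\frac{F(\bar x+u,\bar y)-F(\bar x,\bar y)-\nabla_1F(\bar x,\bar y)(u)}{\|u\|_p}=\theta$ and $\lim_{w\to\theta}\frac{F(\bar x,\bar y+w)-F(\bar x,\bar y)-\nabla_2F(\bar x,\bar y)(w)}{\|w\|_p}=\theta$. *)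

theory Defs
  imports Complex_Main "HOL-Library.Function_Algebras"
begin

text \<open>
  The exponent is a real number, so the sequence space cannot be a type depending on it; it is a
  carrier set of real sequences, together with its norm. Sequences are indexed from \<open>0\<close>: the
  entry \<open>x n\<close> is the \<open>(n+1)\<close>-st term. Sums, differences and the null sequence \<open>0\<close>
  are the pointwise ones on functions.
\<close>

definition lp :: "real \<Rightarrow> (nat \<Rightarrow> real) set" where
  "lp p = {x. summable (\<lambda>n. \<bar>x n\<bar> powr p)}"

definition lp_norm :: "real \<Rightarrow> (nat \<Rightarrow> real) \<Rightarrow> real" where
  "lp_norm p x = (\<Sum>n. \<bar>x n\<bar> powr p) powr (1 / p)"

text \<open>
  Norm convergence. The membership conditions are needed because \<open>lp_norm\<close> is meaningless
  outside \<open>lp p\<close>.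
\<close>

definition lp_tendsto ::
  "real \<Rightarrow> ('a \<Rightarrow> nat \<Rightarrow> real) \<Rightarrow> (nat \<Rightarrow> real) \<Rightarrow> 'a filter \<Rightarrow> bool" where
  "lp_tendsto p f l F \<longleftrightarrow>
     l \<in> lp p \<and> (\<forall>\<^sub>F a in F. f a \<in> lp p) \<and> ((\<lambda>a. lp_norm p (f a - l)) \<longlongrightarrow> 0) F"

definition lp_nhds :: "real \<Rightarrow> (nat \<Rightarrow> real) \<Rightarrow> (nat \<Rightarrow> real) filter" where
  "lp_nhds p x = inf (filtercomap (\<lambda>z. lp_norm p (z - x)) (nhds 0)) (principal (lp p))"

definition lp_at :: "real \<Rightarrow> (nat \<Rightarrow> real) \<Rightarrow> (nat \<Rightarrow> real) filter" where
  "lp_at p x = inf (lp_nhds p x) (principal (- {x}))"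

definition lp_linear :: "real \<Rightarrow> ((nat \<Rightarrow> real) \<Rightarrow> nat \<Rightarrow> real) \<Rightarrow> bool" where
  "lp_linear p A \<longleftrightarrow>
     (\<forall>u\<in>lp p. A u \<in> lp p) \<and>
     (\<forall>u\<in>lp p. \<forall>w\<in>lp p. A (u + w) = A u + A w) \<and>
     (\<forall>c. \<forall>u\<in>lp p. A (\<lambda>n. c * u n) = (\<lambda>n. c * A u n))"

definition lp_continuous :: "real \<Rightarrow> ((nat \<Rightarrow> real) \<Rightarrow> nat \<Rightarrow> real) \<Rightarrow> bool" where
  "lp_continuous p A \<longleftrightarrow> (\<forall>u\<in>lp p. lp_tendsto p A (A u) (lp_nhds p u))"

definition has_gateaux ::
  "real \<Rightarrow> ((nat \<Rightarrow> real) \<Rightarrow> nat \<Rightarrow> real) \<Rightarrow> (nat \<Rightarrow> real) \<Rightarrow> (nat \<Rightarrow> real) \<Rightarrow> (nat \<Rightarrow> real) \<Rightarrow> bool"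
  where
  "has_gateaux p G x v d \<longleftrightarrow>
     lp_tendsto p (\<lambda>t n. (G (x + (\<lambda>k. t * v k)) n - G x n) / t) d (at 0)"

definition has_frechet ::
  "real \<Rightarrow> ((nat \<Rightarrow> real) \<Rightarrow> nat \<Rightarrow> real) \<Rightarrow> (nat \<Rightarrow> real) \<Rightarrow> ((nat \<Rightarrow> real) \<Rightarrow> nat \<Rightarrow> real) \<Rightarrow> bool"
  where
  "has_frechet p G x A \<longleftrightarrow>
     lp_linear p A \<and> lp_continuous p A \<and>
     lp_tendsto p (\<lambda>u n. (G (x + u) n - G x n - A u n) / lp_norm p u) 0 (lp_at p 0)"

definition gateaux_differentiable ::
  "real \<Rightarrow> ((nat \<Rightarrow> real) \<Rightarrow> nat \<Rightarrow> real) \<Rightarrow> (nat \<Rightarrow> real) \<Rightarrow> bool" where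
  "gateaux_differentiable p G x \<longleftrightarrow> (\<forall>v\<in>lp p - {0}. \<exists>d. has_gateaux p G x v d)"

definition frechet_differentiable ::
  "real \<Rightarrow> ((nat \<Rightarrow> real) \<Rightarrow> nat \<Rightarrow> real) \<Rightarrow> (nat \<Rightarrow> real) \<Rightarrow> bool" where
  "frechet_differentiable p G x \<longleftrightarrow> (\<exists>A. has_frechet p G x A)"

definition gateaux_deriv ::
  "real \<Rightarrow> ((nat \<Rightarrow> real) \<Rightarrow> nat \<Rightarrow> real) \<Rightarrow> (nat \<Rightarrow> real) \<Rightarrow> (nat \<Rightarrow> real) \<Rightarrow> nat \<Rightarrow> real" where
  "gateaux_deriv p G x v = (THE d. has_gateaux p G x v d)"

text \<open>
  A Frechet derivative is determined only on \<open>lp p\<close>, not as a function on all sequences;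
  hence the choice operator in place of a definite description.
\<close>

definition frechet_deriv ::
  "real \<Rightarrow> ((nat \<Rightarrow> real) \<Rightarrow> nat \<Rightarrow> real) \<Rightarrow> (nat \<Rightarrow> real) \<Rightarrow> (nat \<Rightarrow> real) \<Rightarrow> nat \<Rightarrow> real" where
  "frechet_deriv p G x = (SOME A. has_frechet p G x A)"

type_synonym seq_map2 = "(nat \<Rightarrow> real) \<Rightarrow> (nat \<Rightarrow> real) \<Rightarrow> nat \<Rightarrow> real"

definition partially_gateaux_differentiable1 ::
  "real \<Rightarrow> seq_map2 \<Rightarrow> (nat \<Rightarrow> real) \<Rightarrow> (nat \<Rightarrow> real) \<Rightarrow> bool" where
  "partially_gateaux_differentiable1 p F x y \<longleftrightarrow> gateaux_differentiable p (\<lambda>z. F z y) x"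

definition partially_gateaux_differentiable2 ::
  "real \<Rightarrow> seq_map2 \<Rightarrow> (nat \<Rightarrow> real) \<Rightarrow> (nat \<Rightarrow> real) \<Rightarrow> bool" where
  "partially_gateaux_differentiable2 p F x y \<longleftrightarrow> gateaux_differentiable p (\<lambda>z. F x z) y"

definition partially_frechet_differentiable1 ::
  "real \<Rightarrow> seq_map2 \<Rightarrow> (nat \<Rightarrow> real) \<Rightarrow> (nat \<Rightarrow> real) \<Rightarrow> bool" where
  "partially_frechet_differentiable1 p F x y \<longleftrightarrow> frechet_differentiable p (\<lambda>z. F z y) x"

definition partially_frechet_differentiable2 ::
  "real \<Rightarrow> seq_map2 \<Rightarrow> (nat \<Rightarrow> real) \<Rightarrow> (nat \<Rightarrow> real) \<Rightarrow> bool" where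
  "partially_frechet_differentiable2 p F x y \<longleftrightarrow> frechet_differentiable p (\<lambda>z. F x z) y"

definition partial_gateaux1 :: "real \<Rightarrow> seq_map2 \<Rightarrow> (nat \<Rightarrow> real) \<Rightarrow> seq_map2" where
  "partial_gateaux1 p F x y = gateaux_deriv p (\<lambda>z. F z y) x"

definition partial_gateaux2 :: "real \<Rightarrow> seq_map2 \<Rightarrow> (nat \<Rightarrow> real) \<Rightarrow> seq_map2" where
  "partial_gateaux2 p F x y = gateaux_deriv p (\<lambda>z. F x z) y"

definition partial_frechet1 :: "real \<Rightarrow> seq_map2 \<Rightarrow> (nat \<Rightarrow> real) \<Rightarrow> seq_map2" where
  "partial_frechet1 p F x y = frechet_deriv p (\<lambda>z. F z y) x"

definition partial_frechet2 :: "real \<Rightarrow> seq_map2 \<Rightarrow> (nat \<Rightarrow> real) \<Rightarrow> seq_map2" where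
  "partial_frechet2 p F x y = frechet_deriv p (\<lambda>z. F x z) y"

text \<open>
  Product of a row vector \<open>t\<close> with the infinite diagonal matrix whose diagonal is \<open>d\<close>.
\<close>

definition row_times_diag :: "(nat \<Rightarrow> real) \<Rightarrow> (nat \<Rightarrow> real) \<Rightarrow> nat \<Rightarrow> real" where
  "row_times_diag t d = (\<lambda>n. d n * t n)"

definition Qpow :: "nat \<Rightarrow> seq_map2" where
  "Qpow m x y = (\<lambda>n. ((x n)\<^sup>2 + y n) ^ m)"

end

theory Submission
  imports Defs
begin

text \<open>
  On the \<open>n\<close>-th entry the two partial maps act through one real function, and neither entry
  influences another: they are superposition operators \<open>z \<mapsto> (g\<^sub>n (z\<^sub>n))\<^sub>n\<close>. Such an operator
  is Frechet differentiable with diagonal derivative as soon as the first-order Taylor remainder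
  of \<open>g\<^sub>n\<close> at the base point is at most \<open>K h\<^sup>2\<close> for \<open>\<bar>h\<bar> \<le> 1\<close>, with the same \<open>K\<close> for all \<open>n\<close>, and
  the diagonal is bounded. Indeed every entry of \<open>u\<close> is at most its norm, so dividing the
  remainder \<open>K u\<^sub>n\<^sup>2\<close> by the norm of \<open>u\<close> leaves at most \<open>K \<bar>u\<^sub>n\<bar>\<close>, and that sequence tends to
  zero in norm together with \<open>u\<close> (lemma \<open>superposition_has_frechet\<close>).

  The uniform constant exists because elements of \<open>lp p\<close> are bounded sequences: the points
  \<open>x\<^sub>n\<^sup>2 + y\<^sub>n\<close> stay in a compact interval, on which \<open>a \<mapsto> a ^ m\<close> has a second-order remainder
  estimate (lemma \<open>power_taylor_remainder_bound\<close>).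

  A Frechet derivative restricts to each line as a Gateaux derivative, and the latter is unique
  because norm limits are entrywise limits. Hence the chosen Frechet derivative and the Gateaux
  derivative both agree with the diagonal operator on every nonzero direction (lemma
  \<open>has_frechet_imp_derivatives\<close>).
\<close>

section \<open>Sequences with summable powers\<close>

lemma lp_norm_nonneg: "0 \<le> lp_norm p x"
  by (simp add: lp_norm_def)

lemma abs_entry_le_lp_norm:
  assumes "0 < p" "x \<in> lp p"
  shows "\<bar>x n\<bar> \<le> lp_norm p x"
proof -
  have s: "summable (\<lambda>n. \<bar>x n\<bar> powr p)" using assms(2) by (simp add: lp_def)
  have "\<bar>x n\<bar> powr p = (\<Sum>k\<in>{n}. \<bar>x k\<bar> powr p)" by simp
  also have "\<dots> \<le> (\<Sum>n. \<bar>x n\<bar> powr p)" by (rule sum_le_suminf[OF s]) auto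
  finally have "(\<bar>x n\<bar> powr p) powr (1/p) \<le> lp_norm p x"
    unfolding lp_norm_def using assms(1) by (intro powr_mono2) auto
  then show ?thesis using assms(1) by (simp add: powr_powr)
qed

lemma lp_norm_pos:
  assumes "0 < p" "x \<in> lp p" "x \<noteq> 0"
  shows "0 < lp_norm p x"
proof -
  obtain n where "x n \<noteq> 0" using assms(3) by (auto simp: fun_eq_iff)
  then show ?thesis using abs_entry_le_lp_norm[OF assms(1,2), of n] by linarith
qed

lemma lp_scale:
  assumes "0 < p" "x \<in> lp p"
  shows "(\<lambda>n. c * x n) \<in> lp p" and "lp_norm p (\<lambda>n. c * x n) = \<bar>c\<bar> * lp_norm p x"
proof -
  have s: "summable (\<lambda>n. \<bar>x n\<bar> powr p)" using assms(2) by (simp add: lp_def)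
  have e: "(\<lambda>n. \<bar>c * x n\<bar> powr p) = (\<lambda>n. \<bar>c\<bar> powr p * \<bar>x n\<bar> powr p)"
    by (simp add: abs_mult powr_mult)
  show "(\<lambda>n. c * x n) \<in> lp p" unfolding lp_def using s by (simp add: e summable_mult)
  show "lp_norm p (\<lambda>n. c * x n) = \<bar>c\<bar> * lp_norm p x"
    using assms(1) s
    by (simp add: lp_norm_def e suminf_mult powr_mult suminf_nonneg powr_powr)
qed

lemma lp_dominated:
  assumes "0 < p" "w \<in> lp p" "0 \<le> c" "\<And>n. \<bar>z n\<bar> \<le> c * \<bar>w n\<bar>"
  shows "z \<in> lp p" and "lp_norm p z \<le> c * lp_norm p w"
proof -
  have s: "summable (\<lambda>n. \<bar>c * w n\<bar> powr p)"
    using lp_scale(1)[OF assms(1,2), of c] by (simp add: lp_def)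
  have le: "\<bar>z n\<bar> powr p \<le> \<bar>c * w n\<bar> powr p" for n
    using assms(1,3) assms(4)[of n] by (intro powr_mono2) (auto simp: abs_mult)
  have s': "summable (\<lambda>n. \<bar>z n\<bar> powr p)"
    by (rule summable_comparison_test'[OF s, of 0]) (use le in auto)
  then show "z \<in> lp p" by (simp add: lp_def)
  have "lp_norm p z \<le> lp_norm p (\<lambda>n. c * w n)"
    unfolding lp_norm_def using assms(1) s s' le
    by (intro powr_mono2[of "1 / p"] suminf_le[OF le] suminf_nonneg) auto
  then show "lp_norm p z \<le> c * lp_norm p w"
    using lp_scale(2)[OF assms(1,2), of c] assms(3) by simp
qed

text \<open>
  Only membership is asserted for a sum, so the crude estimate
  \<open>\<bar>a + b\<bar>\<^sup>p \<le> 2\<^sup>p (\<bar>a\<bar>\<^sup>p + \<bar>b\<bar>\<^sup>p)\<close> replaces Minkowski's inequality.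
\<close>

lemma lp_add:
  assumes "0 < p" "x \<in> lp p" "y \<in> lp p"
  shows "x + y \<in> lp p"
proof -
  have s: "summable (\<lambda>n. 2 powr p * (\<bar>x n\<bar> powr p + \<bar>y n\<bar> powr p))"
    using assms(2,3) by (intro summable_mult summable_add) (auto simp: lp_def)
  have "\<bar>x n + y n\<bar> powr p \<le> 2 powr p * (\<bar>x n\<bar> powr p + \<bar>y n\<bar> powr p)" for n
  proof -
    have "\<bar>x n + y n\<bar> powr p \<le> (2 * max \<bar>x n\<bar> \<bar>y n\<bar>) powr p"
      using assms(1) by (intro powr_mono2) auto
    also have "\<dots> = 2 powr p * max \<bar>x n\<bar> \<bar>y n\<bar> powr p"
      by (simp add: powr_mult)
    also have "\<dots> \<le> 2 powr p * (\<bar>x n\<bar> powr p + \<bar>y n\<bar> powr p)"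
      by (intro mult_left_mono) (auto simp: max_def)
    finally show ?thesis .
  qed
  then have "summable (\<lambda>n. \<bar>x n + y n\<bar> powr p)"
    by (intro summable_comparison_test'[OF s, of 0]) auto
  then show ?thesis by (simp add: lp_def plus_fun_def)
qed

lemma lp_diff:
  assumes "0 < p" "x \<in> lp p" "y \<in> lp p"
  shows "x - y \<in> lp p"
proof -
  have "x - y = x + (\<lambda>n. (-1) * y n)" by (simp add: fun_eq_iff)
  then show ?thesis using lp_add[OF assms(1,2) lp_scale(1)[OF assms(1,3), of "-1"]]
    by (simp only:)
qed

lemma zero_in_lp: "0 < p \<Longrightarrow> 0 \<in> lp p"
  by (simp add: lp_def)

section \<open>Norm limits\<close>

text \<open>
  Continuity of a diagonal operator, smallness of a Frechet remainder, and the passage from a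
  Frechet to a Gateaux derivative are all limits of this kind: the error is dominated, entry by
  entry, by a sequence already known to vanish in norm.
\<close>

lemma lp_tendsto_dominated:
  assumes "0 < p" "l \<in> lp p" "0 \<le> c"
    and ev: "\<forall>\<^sub>F a in F. g a \<in> lp p \<and> (\<forall>n. \<bar>f a n - l n\<bar> \<le> c * \<bar>g a n\<bar>)"
    and g: "((\<lambda>a. lp_norm p (g a)) \<longlongrightarrow> 0) F"
  shows "lp_tendsto p f l F"
proof -
  have "\<forall>\<^sub>F a in F. f a \<in> lp p \<and> lp_norm p (f a - l) \<le> c * lp_norm p (g a)"
    using ev
  proof eventually_elim
    case (elim a)
    then have d: "f a - l \<in> lp p" "lp_norm p (f a - l) \<le> c * lp_norm p (g a)"
      using lp_dominated[of p "g a" c "f a - l"] assms(1,3) by auto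
    have "f a = (f a - l) + l" by simp
    with d show ?case using lp_add[OF assms(1) d(1) assms(2)] by simp
  qed
  then have m: "\<forall>\<^sub>F a in F. f a \<in> lp p"
    and b: "\<forall>\<^sub>F a in F. lp_norm p (f a - l) \<le> c * lp_norm p (g a)"
    by (auto elim: eventually_mono)
  have "((\<lambda>a. c * lp_norm p (g a)) \<longlongrightarrow> 0) F"
    using tendsto_mult_left[OF g, of c] by simp
  then have "((\<lambda>a. lp_norm p (f a - l)) \<longlongrightarrow> 0) F"
    by (rule tendsto_sandwich[rotated 3, of _ _ _ "\<lambda>_. 0"])
       (use b in \<open>auto simp: lp_norm_nonneg\<close>)
  with m assms(2) show ?thesis by (simp add: lp_tendsto_def)
qed

lemma lp_tendsto_imp_entrywise:
  assumes "0 < p" "lp_tendsto p f l F"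
  shows "((\<lambda>a. f a n) \<longlongrightarrow> l n) F"
proof -
  have l: "l \<in> lp p" and m: "\<forall>\<^sub>F a in F. f a \<in> lp p"
    and t: "((\<lambda>a. lp_norm p (f a - l)) \<longlongrightarrow> 0) F"
    using assms(2) by (auto simp: lp_tendsto_def)
  have "\<forall>\<^sub>F a in F. norm (f a n - l n) \<le> lp_norm p (f a - l)"
    using m
  proof eventually_elim
    case (elim a)
    show ?case using abs_entry_le_lp_norm[OF assms(1) lp_diff[OF assms(1) elim l], of n] by simp
  qed
  then have "\<forall>\<^sub>F a in F. norm (f a n - l n) \<le> norm (lp_norm p (f a - l)) * 1"
    by (simp add: lp_norm_nonneg)
  then have "((\<lambda>a. f a n - l n) \<longlongrightarrow> 0) F" by (rule tendsto_0_le[OF t])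
  then show ?thesis by (simp add: LIM_zero_cancel)
qed

lemma eventually_lp_nhds_mem: "\<forall>\<^sub>F z in lp_nhds p x. z \<in> lp p"
  by (simp add: lp_nhds_def eventually_inf_principal)

lemma lp_norm_diff_tendsto_lp_nhds:
  "((\<lambda>z. lp_norm p (z - x)) \<longlongrightarrow> 0) (lp_nhds p x)"
  unfolding lp_nhds_def by (rule filterlim_mono[OF filterlim_filtercomap]) auto

lemma eventually_lp_at_mem: "\<forall>\<^sub>F z in lp_at p x. z \<in> lp p \<and> z \<noteq> x"
  by (simp add: lp_at_def lp_nhds_def eventually_inf_principal)

lemma lp_norm_tendsto_lp_at_0: "(lp_norm p \<longlongrightarrow> 0) (lp_at p 0)"
proof -
  have "((\<lambda>z. lp_norm p (z - 0)) \<longlongrightarrow> 0) (lp_at p 0)"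
    by (rule filterlim_mono[OF lp_norm_diff_tendsto_lp_nhds]) (auto simp: lp_at_def)
  then show ?thesis by simp
qed

lemma filterlim_line_lp_at_0:
  assumes "0 < p" "v \<in> lp p" "v \<noteq> 0"
  shows "filterlim (\<lambda>t n. t * v n) (lp_at p 0) (at 0)"
proof -
  have n: "((\<lambda>t. lp_norm p (\<lambda>n. t * v n)) \<longlongrightarrow> 0) (at 0)"
    unfolding lp_scale(2)[OF assms(1,2)] by (auto intro!: tendsto_eq_intros)
  have nz: "(\<lambda>n. t * v n) \<noteq> 0" if "t \<noteq> 0" for t
    using that assms(3) by (auto simp: fun_eq_iff)
  have "\<forall>\<^sub>F t in at (0::real). (\<lambda>n. t * v n) \<noteq> 0"
    using nz by (auto simp: eventually_at_filter)
  then show ?thesis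
    unfolding lp_at_def lp_nhds_def
    by (simp add: filterlim_inf filterlim_principal filterlim_filtercomap_iff o_def
        lp_scale(1)[OF assms(1,2)] n)
qed

section \<open>Frechet and Gateaux derivatives\<close>

lemma has_frechet_imp_has_gateaux:
  assumes "0 < p" "v \<in> lp p" "v \<noteq> 0" "has_frechet p G x A"
  shows "has_gateaux p G x v (A v)"
proof -
  define q where "q = (\<lambda>u n. (G (x + u) n - G x n - A u n) / lp_norm p u)"
  have lin: "lp_linear p A" and q: "lp_tendsto p q 0 (lp_at p 0)"
    using assms(4) by (auto simp: has_frechet_def q_def)
  have Av: "A v \<in> lp p" and hom: "\<And>t. A (\<lambda>n. t * v n) = (\<lambda>n. t * A v n)"
    using lin assms(2) by (auto simp: lp_linear_def)
  note line = filterlim_line_lp_at_0[OF assms(1-3)]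
  have ev: "\<forall>\<^sub>F t in at 0. q (\<lambda>n. t * v n) \<in> lp p"
    using q line by (auto simp: lp_tendsto_def filterlim_iff)
  have lim: "((\<lambda>t. lp_norm p (q (\<lambda>n. t * v n))) \<longlongrightarrow> 0) (at 0)"
  proof -
    have "((\<lambda>u. lp_norm p (q u)) \<longlongrightarrow> 0) (lp_at p 0)"
      using q by (simp add: lp_tendsto_def)
    from filterlim_compose[OF this line] show ?thesis .
  qed
  \<comment> \<open>Along the line the two remainders differ by the factor \<open>\<parallel>t v\<parallel> / t\<close>, of modulus \<open>\<parallel>v\<parallel>\<close>.\<close>
  have eq: "\<bar>(G (x + (\<lambda>k. t * v k)) n - G x n) / t - A v n\<bar>
      = lp_norm p v * \<bar>q (\<lambda>n. t * v n) n\<bar>" if "t \<noteq> 0" for t n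
  proof -
    let ?R = "G (x + (\<lambda>k. t * v k)) n - G x n - t * A v n"
    have "(G (x + (\<lambda>k. t * v k)) n - G x n) / t - A v n = ?R / t"
      using that by (simp add: field_simps)
    moreover have "\<bar>q (\<lambda>n. t * v n) n\<bar> = \<bar>?R\<bar> / (\<bar>t\<bar> * lp_norm p v)"
      by (simp add: q_def hom lp_scale(2)[OF assms(1,2)] abs_mult lp_norm_nonneg)
    ultimately show ?thesis
      using lp_norm_pos[OF assms(1-3)] by (simp add: field_simps)
  qed
  have "\<forall>\<^sub>F t in at (0::real). t \<noteq> 0" by (simp add: eventually_at_filter)
  with ev have "\<forall>\<^sub>F t in at 0. q (\<lambda>n. t * v n) \<in> lp p \<and>
      (\<forall>n. \<bar>(G (x + (\<lambda>k. t * v k)) n - G x n) / t - A v n\<bar>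
        \<le> lp_norm p v * \<bar>q (\<lambda>n. t * v n) n\<bar>)"
    by eventually_elim (simp add: eq)
  then show ?thesis
    unfolding has_gateaux_def
    by (rule lp_tendsto_dominated[OF assms(1) Av lp_norm_nonneg _ lim])
qed

lemma has_gateaux_unique:
  assumes "0 < p" "has_gateaux p G x v d" "has_gateaux p G x v d'"
  shows "d = d'"
proof
  fix n
  show "d n = d' n"
    using lp_tendsto_imp_entrywise[OF assms(1) assms(2)[unfolded has_gateaux_def], of n]
      lp_tendsto_imp_entrywise[OF assms(1) assms(3)[unfolded has_gateaux_def], of n]
    by (intro tendsto_unique) auto
qed

lemma has_frechet_imp_derivatives:
  assumes "0 < p" "has_frechet p G x A"
  shows "frechet_differentiable p G x" and "gateaux_differentiable p G x"
    and "v \<in> lp p - {0} \<Longrightarrow> gateaux_deriv p G x v = A v"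
    and "v \<in> lp p - {0} \<Longrightarrow> frechet_deriv p G x v = A v"
proof -
  show "frechet_differentiable p G x" using assms(2) by (auto simp: frechet_differentiable_def)
  show "gateaux_differentiable p G x"
    using has_frechet_imp_has_gateaux[OF assms(1) _ _ assms(2)]
    by (auto simp: gateaux_differentiable_def)
  assume v: "v \<in> lp p - {0}"
  then have g: "has_gateaux p G x v (A v)"
    using has_frechet_imp_has_gateaux[OF assms(1) _ _ assms(2)] by auto
  then show "gateaux_deriv p G x v = A v"
    unfolding gateaux_deriv_def using has_gateaux_unique[OF assms(1)] by (intro the_equality) auto
  have "has_frechet p G x (frechet_deriv p G x)"
    unfolding frechet_deriv_def by (rule someI[where P = "has_frechet p G x", OF assms(2)])
  then have "has_gateaux p G x v (frechet_deriv p G x v)"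
    using has_frechet_imp_has_gateaux[OF assms(1)] v by auto
  then show "frechet_deriv p G x v = A v" using g has_gateaux_unique[OF assms(1)] by blast
qed

section \<open>Superposition operators\<close>

lemma row_times_diag_lp:
  assumes "0 < p" "u \<in> lp p" "\<And>n. \<bar>d n\<bar> \<le> D"
  shows "row_times_diag u d \<in> lp p"
proof (rule lp_dominated(1)[OF assms(1,2)])
  show "0 \<le> D" using assms(3)[of 0] by linarith
  show "\<bar>row_times_diag u d n\<bar> \<le> D * \<bar>u n\<bar>" for n
    using assms(3)[of n] by (auto simp: row_times_diag_def abs_mult intro: mult_right_mono)
qed

text \<open>
  The norm dominates every entry, so a direction of norm below \<open>1\<close> has all its entries in the
  range where the remainder estimate applies, and one of the two factors \<open>\<bar>u n\<bar>\<close> in that estimate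
  is absorbed by the division by the norm.
\<close>

lemma superposition_has_frechet:
  assumes p: "0 < p" and D: "\<And>n. \<bar>d n\<bar> \<le> D"
    and rem: "\<And>n h. \<bar>h\<bar> \<le> 1 \<Longrightarrow> \<bar>g n (x n + h) - g n (x n) - d n * h\<bar> \<le> K * h\<^sup>2"
  shows "has_frechet p (\<lambda>z n. g n (z n)) x (\<lambda>u. row_times_diag u d)"
proof -
  have D0: "0 \<le> D" using D[of 0] by linarith
  have K0: "0 \<le> K" using rem[of 1 0] by simp
  have "lp_linear p (\<lambda>u. row_times_diag u d)"
    using row_times_diag_lp[OF p _ D]
    by (auto simp: lp_linear_def row_times_diag_def fun_eq_iff algebra_simps)
  moreover have "lp_continuous p (\<lambda>u. row_times_diag u d)"
    unfolding lp_continuous_def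
  proof
    fix u assume u: "u \<in> lp p"
    show "lp_tendsto p (\<lambda>u. row_times_diag u d) (row_times_diag u d) (lp_nhds p u)"
    proof (rule lp_tendsto_dominated[OF p row_times_diag_lp[OF p u D] D0 _
            lp_norm_diff_tendsto_lp_nhds])
      show "\<forall>\<^sub>F z in lp_nhds p u. z - u \<in> lp p \<and>
          (\<forall>n. \<bar>row_times_diag z d n - row_times_diag u d n\<bar> \<le> D * \<bar>(z - u) n\<bar>)"
        using eventually_lp_nhds_mem
      proof eventually_elim
        case (elim z)
        have "\<bar>row_times_diag z d n - row_times_diag u d n\<bar> = \<bar>d n\<bar> * \<bar>(z - u) n\<bar>" for n
          by (simp add: row_times_diag_def abs_mult flip: right_diff_distrib)
        then show ?case using lp_diff[OF p elim u] D by (auto intro: mult_right_mono)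
      qed
    qed
  qed
  moreover have "lp_tendsto p
      (\<lambda>u n. (g n ((x + u) n) - g n (x n) - row_times_diag u d n) / lp_norm p u) 0 (lp_at p 0)"
  proof (rule lp_tendsto_dominated[OF p zero_in_lp[OF p] K0 _ lp_norm_tendsto_lp_at_0])
    have "\<forall>\<^sub>F u in lp_at p 0. lp_norm p u < 1"
      using order_tendstoD(2)[OF lp_norm_tendsto_lp_at_0, of 1] by simp
    with eventually_lp_at_mem[of p 0]
    show "\<forall>\<^sub>F u in lp_at p 0. u \<in> lp p \<and> (\<forall>n.
        \<bar>(g n ((x + u) n) - g n (x n) - row_times_diag u d n) / lp_norm p u - 0 n\<bar> \<le> K * \<bar>u n\<bar>)"
    proof eventually_elim
      case (elim u)
      then have u: "u \<in> lp p" and pos: "0 < lp_norm p u" using lp_norm_pos[OF p] by auto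
      have "\<bar>g n (x n + u n) - g n (x n) - d n * u n\<bar> / lp_norm p u \<le> K * \<bar>u n\<bar>" for n
      proof -
        have le: "\<bar>u n\<bar> \<le> lp_norm p u" by (rule abs_entry_le_lp_norm[OF p u])
        have "\<bar>g n (x n + u n) - g n (x n) - d n * u n\<bar> \<le> K * (u n)\<^sup>2"
          using le elim by (intro rem) linarith
        also have "\<dots> = K * (\<bar>u n\<bar> * \<bar>u n\<bar>)" by (simp add: power2_eq_square)
        also have "\<dots> \<le> K * (\<bar>u n\<bar> * lp_norm p u)"
          by (intro mult_left_mono le K0) auto
        finally show ?thesis using pos by (simp add: divide_le_eq mult.assoc)
      qed
      then show ?case using u pos by (simp add: row_times_diag_def abs_divide)
    qed
  qed
  ultimately show ?thesis by (simp add: has_frechet_def)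
qed

section \<open>Powers of bounded quantities\<close>

text \<open>
  Passing from exponent \<open>m\<close> to \<open>m + 1\<close> multiplies the remainder by \<open>a + k\<close> and adds
  \<open>m a\<^sup>m\<^sup>-\<^sup>1 k\<^sup>2\<close>, which gives a recursion for the constant.
\<close>

lemma power_taylor_remainder_bound:
  fixes C :: real
  shows "\<exists>K\<ge>0. \<forall>a k. \<bar>a\<bar> \<le> C \<longrightarrow> \<bar>k\<bar> \<le> C \<longrightarrow>
           \<bar>(a + k) ^ m - a ^ m - real m * a ^ (m - 1) * k\<bar> \<le> K * k\<^sup>2"
proof (induction m)
  case 0
  show ?case by (rule exI[of _ 0]) simp
next
  case (Suc m)
  then obtain K where K0: "0 \<le> K" and K: "\<And>a k. \<bar>a\<bar> \<le> C \<Longrightarrow> \<bar>k\<bar> \<le> C \<Longrightarrow>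
      \<bar>(a + k) ^ m - a ^ m - real m * a ^ (m - 1) * k\<bar> \<le> K * k\<^sup>2"
    by blast
  have "\<bar>(a + k) ^ Suc m - a ^ Suc m - real (Suc m) * a ^ m * k\<bar>
      \<le> (2 * \<bar>C\<bar> * K + real m * \<bar>C\<bar> ^ (m - 1)) * k\<^sup>2" if a: "\<bar>a\<bar> \<le> C" and k: "\<bar>k\<bar> \<le> C" for a k
  proof -
    let ?R = "(a + k) ^ m - a ^ m - real m * a ^ (m - 1) * k"
    have "(a + k) ^ Suc m - a ^ Suc m - real (Suc m) * a ^ m * k
        = (a + k) * ?R + real m * a ^ (m - 1) * k\<^sup>2"
      by (cases m) (simp_all add: algebra_simps power2_eq_square)
    also have "\<bar>\<dots>\<bar> \<le> \<bar>a + k\<bar> * \<bar>?R\<bar> + real m * \<bar>a\<bar> ^ (m - 1) * k\<^sup>2"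
      by (rule order_trans[OF abs_triangle_ineq]) (simp add: abs_mult power_abs)
    also have "\<dots> \<le> (2 * \<bar>C\<bar>) * (K * k\<^sup>2) + real m * \<bar>C\<bar> ^ (m - 1) * k\<^sup>2"
      using a k K0 by (intro add_mono mult_mono power_mono K order_refl) auto
    finally show ?thesis by (simp add: algebra_simps)
  qed
  then show ?case using K0 by (intro exI[of _ "2 * \<bar>C\<bar> * K + real m * \<bar>C\<bar> ^ (m - 1)"]) auto
qed

lemma square_plus_bounded:
  assumes "\<bar>s\<bar> \<le> X" "\<bar>t\<bar> \<le> (Y::real)"
  shows "\<bar>s\<^sup>2 + t\<bar> \<le> X\<^sup>2 + Y"
proof -
  have "s\<^sup>2 \<le> X\<^sup>2" using power_mono[OF assms(1), of 2] by simp
  then show ?thesis using assms(2) zero_le_power2[of s] by linarith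
qed

section \<open>The operator and its partial derivatives\<close>

context
  fixes p :: real and x y :: "nat \<Rightarrow> real"
  assumes p: "0 < p" and x: "x \<in> lp p" and y: "y \<in> lp p"
begin

lemma lp_square_plus_bounded: "\<bar>(x n)\<^sup>2 + y n\<bar> \<le> (lp_norm p x)\<^sup>2 + lp_norm p y"
  by (intro square_plus_bounded abs_entry_le_lp_norm p x y)

lemma lp_square_plus_power_bounded:
  "\<bar>((x n)\<^sup>2 + y n) ^ k\<bar> \<le> ((lp_norm p x)\<^sup>2 + lp_norm p y) ^ k"
  using power_mono[OF lp_square_plus_bounded, of n k] by (simp add: power_abs)

lemma Qpow_in_lp:
  assumes "0 < m"
  shows "Qpow m x y \<in> lp p"
proof -
  have "(\<lambda>n. (x n)\<^sup>2 + y n) = row_times_diag x x + y"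
    by (simp add: fun_eq_iff row_times_diag_def power2_eq_square)
  then have "(\<lambda>n. (x n)\<^sup>2 + y n) \<in> lp p"
    using lp_add[OF p row_times_diag_lp[OF p x abs_entry_le_lp_norm[OF p x]] y] by simp
  then have "row_times_diag (\<lambda>n. (x n)\<^sup>2 + y n) (\<lambda>n. ((x n)\<^sup>2 + y n) ^ (m - 1)) \<in> lp p"
    by (rule row_times_diag_lp[OF p _ lp_square_plus_power_bounded])
  then show ?thesis
    using assms by (cases m) (simp_all add: row_times_diag_def Qpow_def power_commutes)
qed

text \<open>
  The increment \<open>h\<close> of \<open>x n\<close> changes the base of the power by \<open>k = 2 x\<^sub>n h + h\<^sup>2\<close>. Its linear
  part yields the derivative; \<open>k\<^sup>2\<close> and the stray \<open>h\<^sup>2\<close> are both of second order.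
\<close>

lemma Qpow_has_frechet1:
  "has_frechet p (\<lambda>z. Qpow m z y) x
     (\<lambda>u. row_times_diag u (\<lambda>n. 2 * real m * x n * ((x n)\<^sup>2 + y n) ^ (m - 1)))"
proof -
  define X where "X = lp_norm p x"
  define B where "B = X\<^sup>2 + lp_norm p y"
  have X0: "0 \<le> X" and Y0: "0 \<le> lp_norm p y" by (simp_all add: X_def lp_norm_nonneg)
  have B0: "0 \<le> B" using Y0 by (simp add: B_def)
  have xX: "\<bar>x n\<bar> \<le> X" for n unfolding X_def by (rule abs_entry_le_lp_norm[OF p x])
  have bB: "\<bar>(x n)\<^sup>2 + y n\<bar> \<le> B" for n using lp_square_plus_bounded by (simp add: B_def X_def)
  have bB': "\<bar>(x n)\<^sup>2 + y n\<bar> ^ k \<le> B ^ k" for n k by (intro power_mono bB) simp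
  \<comment> \<open>The base points are at most \<open>B\<close>, and \<open>\<bar>2 x\<^sub>n h + h\<^sup>2\<bar> \<le> 2 X + 1\<close>; the sum serves for both.\<close>
  obtain K where K0: "0 \<le> K" and K: "\<And>a k. \<bar>a\<bar> \<le> B + (2 * X + 1) \<Longrightarrow> \<bar>k\<bar> \<le> B + (2 * X + 1) \<Longrightarrow>
      \<bar>(a + k) ^ m - a ^ m - real m * a ^ (m - 1) * k\<bar> \<le> K * k\<^sup>2"
    using power_taylor_remainder_bound[of "B + (2 * X + 1)" m] by blast
  show ?thesis
    unfolding Qpow_def
  proof (rule superposition_has_frechet[OF p,
        where D = "2 * real m * X * B ^ (m - 1)"
          and K = "K * (2 * X + 1)\<^sup>2 + real m * B ^ (m - 1)"
          and g = "\<lambda>n z. (z\<^sup>2 + y n) ^ m"])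
    show "\<bar>2 * real m * x n * ((x n)\<^sup>2 + y n) ^ (m - 1)\<bar> \<le> 2 * real m * X * B ^ (m - 1)" for n
      unfolding abs_mult power_abs using X0 by (intro mult_mono xX bB') auto
  next
    fix n and h :: real assume h: "\<bar>h\<bar> \<le> 1"
    define a where "a = (x n)\<^sup>2 + y n"
    define k where "k = 2 * x n * h + h\<^sup>2"
    have "\<bar>k\<bar> = \<bar>2 * x n + h\<bar> * \<bar>h\<bar>"
      by (simp add: k_def power2_eq_square algebra_simps flip: abs_mult)
    also have "\<dots> \<le> (2 * X + 1) * \<bar>h\<bar>"
      using xX[of n] h by (intro mult_right_mono) auto
    finally have kh: "\<bar>k\<bar> \<le> (2 * X + 1) * \<bar>h\<bar>" .
    also have "\<dots> \<le> (2 * X + 1) * 1" using h X0 by (intro mult_left_mono) auto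
    finally have kB: "\<bar>k\<bar> \<le> B + (2 * X + 1)" using B0 by simp
    have k2: "k\<^sup>2 \<le> (2 * X + 1)\<^sup>2 * h\<^sup>2"
      using power_mono[OF kh, of 2] by (simp add: power_mult_distrib)
    have aB: "\<bar>a\<bar> \<le> B + (2 * X + 1)" using bB[of n] X0 by (simp add: a_def)
    let ?R = "(a + k) ^ m - a ^ m - real m * a ^ (m - 1) * k"
    have "((x n + h)\<^sup>2 + y n) = a + k"
      by (simp add: a_def k_def power2_eq_square algebra_simps)
    then have "((x n + h)\<^sup>2 + y n) ^ m - ((x n)\<^sup>2 + y n) ^ m
        - 2 * real m * x n * ((x n)\<^sup>2 + y n) ^ (m - 1) * h
      = ?R + real m * a ^ (m - 1) * h\<^sup>2"
      by (simp add: a_def[symmetric]) (simp add: k_def algebra_simps)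
    also have "\<bar>\<dots>\<bar> \<le> \<bar>?R\<bar> + real m * \<bar>a\<bar> ^ (m - 1) * h\<^sup>2"
      by (rule order_trans[OF abs_triangle_ineq]) (simp add: abs_mult power_abs)
    also have "\<dots> \<le> K * ((2 * X + 1)\<^sup>2 * h\<^sup>2) + real m * B ^ (m - 1) * h\<^sup>2"
    proof (intro add_mono mult_right_mono mult_left_mono)
      show "\<bar>?R\<bar> \<le> K * ((2 * X + 1)\<^sup>2 * h\<^sup>2)"
        using K[OF aB kB] mult_left_mono[OF k2 K0] by linarith
      show "\<bar>a\<bar> ^ (m - 1) \<le> B ^ (m - 1)" unfolding a_def by (rule bB')
    qed auto
    finally show "\<bar>((x n + h)\<^sup>2 + y n) ^ m - ((x n)\<^sup>2 + y n) ^ m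
        - 2 * real m * x n * ((x n)\<^sup>2 + y n) ^ (m - 1) * h\<bar>
      \<le> (K * (2 * X + 1)\<^sup>2 + real m * B ^ (m - 1)) * h\<^sup>2"
      by (simp add: algebra_simps)
  qed
qed

lemma Qpow_has_frechet2:
  "has_frechet p (\<lambda>z. Qpow m x z) y
     (\<lambda>u. row_times_diag u (\<lambda>n. real m * ((x n)\<^sup>2 + y n) ^ (m - 1)))"
proof -
  define B where "B = (lp_norm p x)\<^sup>2 + lp_norm p y"
  have B0: "0 \<le> B" by (simp add: B_def lp_norm_nonneg)
  have bB: "\<bar>(x n)\<^sup>2 + y n\<bar> \<le> B" for n using lp_square_plus_bounded by (simp add: B_def)
  obtain K where K: "\<And>a k. \<bar>a\<bar> \<le> B + 1 \<Longrightarrow> \<bar>k\<bar> \<le> B + 1 \<Longrightarrow>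
      \<bar>(a + k) ^ m - a ^ m - real m * a ^ (m - 1) * k\<bar> \<le> K * k\<^sup>2"
    using power_taylor_remainder_bound[of "B + 1" m] by blast
  show ?thesis
    unfolding Qpow_def
  proof (rule superposition_has_frechet[OF p, where D = "real m * B ^ (m - 1)"
        and K = K and g = "\<lambda>n z. ((x n)\<^sup>2 + z) ^ m"])
    show "\<bar>real m * ((x n)\<^sup>2 + y n) ^ (m - 1)\<bar> \<le> real m * B ^ (m - 1)" for n
      using lp_square_plus_power_bounded[of n "m - 1"]
      by (auto simp: abs_mult B_def intro: mult_left_mono)
    show "\<bar>((x n)\<^sup>2 + (y n + h)) ^ m - ((x n)\<^sup>2 + y n) ^ m
        - real m * ((x n)\<^sup>2 + y n) ^ (m - 1) * h\<bar> \<le> K * h\<^sup>2" if "\<bar>h\<bar> \<le> 1" for n h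
      using K[of "(x n)\<^sup>2 + y n" h] bB[of n] B0 that by (simp add: add.assoc)
  qed
qed

end

theorem corollary3p2:
  fixes p :: real and m :: nat
  assumes "1 < p" and "0 < m"
  shows
    "(\<forall>x\<in>lp p. \<forall>y\<in>lp p. Qpow m x y \<in> lp p) \<and>
     (\<forall>x\<in>lp p. \<forall>y\<in>lp p.
        partially_gateaux_differentiable1 p (Qpow m) x y \<and>
        partially_gateaux_differentiable2 p (Qpow m) x y) \<and>
     (\<forall>x\<in>lp p. \<forall>y\<in>lp p.
        (partially_frechet_differentiable1 p (Qpow m) x y \<and>
         (\<forall>v\<in>lp p - {0}.
            partial_gateaux1 p (Qpow m) x y v = partial_frechet1 p (Qpow m) x y v \<and>
            partial_frechet1 p (Qpow m) x y v =
              row_times_diag v (\<lambda>n. 2 * real m * x n * ((x n)\<^sup>2 + y n) ^ (m - 1)))) \<and>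
        (partially_frechet_differentiable2 p (Qpow m) x y \<and>
         (\<forall>u\<in>lp p - {0}.
            partial_gateaux2 p (Qpow m) x y u = partial_frechet2 p (Qpow m) x y u \<and>
            partial_frechet2 p (Qpow m) x y u =
              row_times_diag u (\<lambda>n. real m * ((x n)\<^sup>2 + y n) ^ (m - 1)))))"
proof -
  have p: "0 < p" using assms(1) by simp
  note d1 = has_frechet_imp_derivatives[OF p Qpow_has_frechet1[OF p]]
  note d2 = has_frechet_imp_derivatives[OF p Qpow_has_frechet2[OF p]]
  show ?thesis
    unfolding partially_gateaux_differentiable1_def partially_gateaux_differentiable2_def
      partially_frechet_differentiable1_def partially_frechet_differentiable2_def
      partial_gateaux1_def partial_gateaux2_def partial_frechet1_def partial_frechet2_def
    using Qpow_in_lp[OF p _ _ assms(2)] d1 d2 by auto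
qed

end
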